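(* There exist absolute constants $0<c\le C$ such that for infinitely many positive integers $n$ there is a family of diagonal matrices $A_1,\dots,A_n\in\mathbb R^{n\times n}$ with $\|A_i\|_{\mathrm{op}}\le 1$ for all $i$, $$c\sqrt{\log n}\ \le\ \mathrm{disc}(A_1,\dots,A_n)\ \le\ C\sqrt{\log n},$$ and $$c\ \le\ \Bigl\|\sum_{i=1}^nA_i^2\Bigr\|_{\mathrm{op}}^{1/2}\ \le\ C .$$
   Context: $\|\cdot\|_{\mathrm{op}}$ is the operator norm, and $\mathrm{disc}(A_1,\dots,A_n):=\min_{x\in\{\pm1\}^n}\bigl\|\sum_{i=1}^n x_iA_i\bigr\|_{\mathrm{op}}$. *)

theory Defs
  imports Complex_Main "HOL-Library.FuncSet" "Jordan_Normal_Form.Matrix"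
begin

definition vec_norm2 :: "real vec \<Rightarrow> real" where
  "vec_norm2 v = sqrt (v \<bullet> v)"

(* The supremum ranges over the closed unit ball rather than the unit sphere, so that the set is
   nonempty also when dim_col A = 0. *)
definition op_norm :: "real mat \<Rightarrow> real" where
  "op_norm A = Sup {vec_norm2 (A *\<^sub>v v) | v. v \<in> carrier_vec (dim_col A) \<and> vec_norm2 v \<le> 1}"

(* The type of matrices of all dimensions has no zero, so the big sum over the type class
   comm_monoid_add is not available; this is the sum in the ring of d x d matrices. *)
definition mat_sum :: "nat \<Rightarrow> (nat \<Rightarrow> real mat) \<Rightarrow> nat set \<Rightarrow> real mat" where
  "mat_sum d A I = finsum (ring_mat TYPE(real) d ()) A I"

definition signs :: "nat \<Rightarrow> (nat \<Rightarrow> real) set" where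
  "signs n = {1..n} \<rightarrow>\<^sub>E {-1, 1}"

(* The discrepancy of n matrices A 1, ..., A n of size d x d. *)
definition disc :: "nat \<Rightarrow> nat \<Rightarrow> (nat \<Rightarrow> real mat) \<Rightarrow> real" where
  "disc d n A = Min ((\<lambda>x. op_norm (mat_sum d (\<lambda>i. x i \<cdot>\<^sub>m A i) {1..n})) ` signs n)"

end

theory Submission
  imports Defs
begin

text \<open>
  For diagonal matrices the operator norm is the largest absolute diagonal entry, so a family of
  diagonal matrices is an array whose rows are coordinates and whose columns are the matrices, and
  the discrepancy asks for a sign vector \<open>x\<close> that makes all the inner products of \<open>x\<close> with the rows
  small.  If all \<open>2 ^ m\<close> sign patterns of length \<open>m\<close> occur among the rows, then one of the rows
  agrees with \<open>x\<close>, and no choice of \<open>x\<close> avoids the inner product \<open>m\<close>.  Dividing by \<open>sqrt m\<close> makes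
  every row a unit vector, so that the squares sum to the identity matrix, while the discrepancy
  is exactly \<open>sqrt m\<close> (\<open>disc_sign_family\<close>).

  With \<open>n = 2 ^ m\<close> rows, \<open>m = log\<^sub>2 n\<close>, so this discrepancy has order \<open>sqrt (ln n)\<close>.  Only \<open>m\<close> columns
  are in use; zero matrices fill the family up to \<open>n\<close> members without changing any of the sums.
\<close>

lemma vec_norm2_eq: "vec_norm2 v = sqrt (\<Sum>j<dim_vec v. (v $ j)\<^sup>2)"
  by (simp add: vec_norm2_def scalar_prod_def power2_eq_square atLeast0LessThan)

lemma mat_diag_mult_vec:
  "v \<in> carrier_vec d \<Longrightarrow> mat_diag d f *\<^sub>v v = vec d (\<lambda>j. f j * v $ j)"
  by (intro eq_vecI)
     (auto simp: mat_diag_def scalar_prod_def if_distrib if_distribR sum.delta cong: if_cong)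

text \<open>A bound on the entries is inherited by the norm; the unit vector at an extremal entry shows
  that it is attained.\<close>

lemma op_norm_mat_diag:
  assumes bound: "\<And>j. j < d \<Longrightarrow> \<bar>f j\<bar> \<le> M" and k: "k < d" "\<bar>f k\<bar> = M"
  shows "op_norm (mat_diag d f) = M"
  unfolding op_norm_def
proof (rule cSup_eq_maximum)
  have unit: "unit_vec d k \<in> carrier_vec d"
    by simp
  have sq: "(unit_vec d k $ j)\<^sup>2 = (if j = k then 1 else (0::real))" if "j < d" for j
    using that k by simp
  have "vec_norm2 (unit_vec d k) = 1"
    using k sq by (simp add: vec_norm2_eq)
  moreover have "vec_norm2 (mat_diag d f *\<^sub>v unit_vec d k) = M"
  proof -
    have "(\<Sum>j<d. (f j * unit_vec d k $ j)\<^sup>2) = (\<Sum>j<d. if j = k then (f k)\<^sup>2 else 0)"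
      using sq by (intro sum.cong) (auto simp: power_mult_distrib)
    then show ?thesis
      using k by (simp add: mat_diag_mult_vec[OF unit] vec_norm2_eq)
  qed
  ultimately show "M \<in> {vec_norm2 (mat_diag d f *\<^sub>v v) |v.
      v \<in> carrier_vec (dim_col (mat_diag d f)) \<and> vec_norm2 v \<le> 1}"
    using unit by (auto simp: mat_diag_def intro!: exI[of _ "unit_vec d k"])
next
  fix y
  assume "y \<in> {vec_norm2 (mat_diag d f *\<^sub>v v) |v.
      v \<in> carrier_vec (dim_col (mat_diag d f)) \<and> vec_norm2 v \<le> 1}"
  then obtain v where v: "v \<in> carrier_vec d" "vec_norm2 v \<le> 1"
    and y: "y = vec_norm2 (mat_diag d f *\<^sub>v v)"
    by (auto simp: mat_diag_def)
  have M: "0 \<le> M"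
    using k by auto
  have "(\<Sum>j<d. (f j * v $ j)\<^sup>2) \<le> (\<Sum>j<d. M\<^sup>2 * (v $ j)\<^sup>2)"
  proof (rule sum_mono)
    fix j assume "j \<in> {..<d}"
    then have "(f j)\<^sup>2 \<le> M\<^sup>2"
      using power_mono[OF bound, of j 2] by simp
    then show "(f j * v $ j)\<^sup>2 \<le> M\<^sup>2 * (v $ j)\<^sup>2"
      by (simp add: power_mult_distrib mult_right_mono)
  qed
  then have "y \<le> sqrt (M\<^sup>2 * (\<Sum>j<d. (v $ j)\<^sup>2))"
    using v by (simp add: y mat_diag_mult_vec vec_norm2_eq sum_distrib_left)
  also have "\<dots> = M * vec_norm2 v"
    using v M by (simp add: vec_norm2_eq real_sqrt_mult)
  also have "\<dots> \<le> M"
    using mult_left_mono[OF v(2) M] by simp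
  finally show "y \<le> M" .
qed

lemma mat_sum_mat_diag:
  assumes "finite I"
  shows "mat_sum d (\<lambda>i. mat_diag d (g i)) I = mat_diag d (\<lambda>j. \<Sum>i\<in>I. g i j)"
  using assms
proof (induction I rule: finite_induct)
  interpret R: ring "ring_mat TYPE(real) d ()"
    by (rule ring_mat)
  case empty
  have "0\<^sub>m d d = mat_diag d (\<lambda>j. 0 :: real)"
    by (intro eq_matI) (auto simp: mat_diag_def)
  then show ?case
    by (simp add: mat_sum_def ring_mat_simps)
next
  interpret R: ring "ring_mat TYPE(real) d ()"
    by (rule ring_mat)
  case (insert i I)
  have "mat_sum d (\<lambda>i. mat_diag d (g i)) (insert i I)
      = mat_diag d (g i) + mat_sum d (\<lambda>i. mat_diag d (g i)) I"
    unfolding mat_sum_def using insert.hyps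
    by (subst R.finsum_insert) (auto simp: ring_mat_simps)
  also have "\<dots> = mat_diag d (\<lambda>j. \<Sum>i\<in>insert i I. g i j)"
    unfolding insert.IH using insert.hyps by (intro eq_matI) (auto simp: mat_diag_def)
  finally show ?case .
qed

text \<open>A sign pattern is encoded as the set \<open>h j\<close> of its positive positions, so that any enumeration of
  the powerset of \<open>{1..m}\<close> yields all the patterns.  The columns beyond \<open>m\<close> are the padding.\<close>

definition sign_row :: "nat \<Rightarrow> (nat \<Rightarrow> nat set) \<Rightarrow> nat \<Rightarrow> nat \<Rightarrow> real" where
  "sign_row m h i j = (if i \<in> {1..m} then (if i \<in> h j then 1 else - 1) / sqrt (real m) else 0)"

lemma sum_sign_row:
  assumes "m \<le> n"
  shows "(\<Sum>i\<in>{1..n}. x i * sign_row m h i j)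
    = (\<Sum>i\<in>{1..m}. x i * (if i \<in> h j then 1 else - 1)) / sqrt (real m)"
proof -
  have "(\<Sum>i\<in>{1..n}. x i * sign_row m h i j) = (\<Sum>i\<in>{1..m}. x i * sign_row m h i j)"
    using assms by (intro sum.mono_neutral_right) (auto simp: sign_row_def)
  also have "\<dots> = (\<Sum>i\<in>{1..m}. x i * (if i \<in> h j then 1 else - 1)) / sqrt (real m)"
    unfolding sum_divide_distrib by (intro sum.cong) (auto simp: sign_row_def)
  finally show ?thesis .
qed

lemma sum_sign_row_squares:
  assumes "0 < m" "m \<le> n"
  shows "(\<Sum>i\<in>{1..n}. sign_row m h i j * sign_row m h i j) = 1"
proof -
  have "(\<Sum>i\<in>{1..n}. sign_row m h i j * sign_row m h i j) = (\<Sum>i\<in>{1..m}. 1 / real m)"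
    using assms by (intro sum.mono_neutral_cong_right) (auto simp: sign_row_def)
  then show ?thesis
    using assms by simp
qed

text \<open>Every sign vector has the same worst row, namely the one with its own signs on \<open>{1..m}\<close>.  It
  meets the trivial bound for an inner product of \<open>m\<close> signs, so the minimum is over equal values.\<close>

lemma disc_sign_family:
  assumes m: "0 < m" "m \<le> n" and h: "Pow {1..m} \<subseteq> h ` {..<n}"
  shows "disc n n (\<lambda>i. mat_diag n (sign_row m h i)) = sqrt (real m)"
proof -
  have norm: "op_norm (mat_sum n (\<lambda>i. x i \<cdot>\<^sub>m mat_diag n (sign_row m h i)) {1..n}) = sqrt (real m)"
    if x: "x \<in> signs n" for x
  proof -
    have smult: "x i \<cdot>\<^sub>m mat_diag n (sign_row m h i) = mat_diag n (\<lambda>j. x i * sign_row m h i j)" for i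
      by (intro eq_matI) (auto simp: mat_diag_def)
    have sign: "x i = -1 \<or> x i = 1" if "i \<in> {1..m}" for i
      using x that m by (auto simp: signs_def PiE_def Pi_def)
    let ?s = "\<lambda>j. \<Sum>i\<in>{1..m}. x i * (if i \<in> h j then 1 else - 1)"
    have "op_norm (mat_diag n (\<lambda>j. ?s j / sqrt (real m))) = sqrt (real m)"
    proof -
      have "{i \<in> {1..m}. x i = 1} \<in> h ` {..<n}"
        using h by auto
      then obtain k where k: "k < n" "h k = {i \<in> {1..m}. x i = 1}"
        by auto
      show ?thesis
      proof (rule op_norm_mat_diag[OF _ k(1)])
        fix j
        have "\<bar>?s j\<bar> \<le> (\<Sum>i\<in>{1..m}. \<bar>x i * (if i \<in> h j then 1 else - 1)\<bar>)"
          by (rule sum_abs)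
        also have "\<dots> = (\<Sum>i\<in>{1..m}. 1)"
          by (rule sum.cong) (use sign in \<open>force simp: abs_mult\<close>)+
        finally have "\<bar>?s j\<bar> / sqrt (real m) \<le> real m / sqrt (real m)"
          by (intro divide_right_mono) auto
        then show "\<bar>?s j / sqrt (real m)\<bar> \<le> sqrt (real m)"
          by (simp add: real_div_sqrt)
      next
        have "?s k = (\<Sum>i\<in>{1..m}. 1)"
          using sign k(2) by (intro sum.cong) auto
        then show "\<bar>?s k / sqrt (real m)\<bar> = sqrt (real m)"
          by (simp add: real_div_sqrt)
      qed
    qed
    then show ?thesis
      by (simp add: smult mat_sum_mat_diag sum_sign_row[OF m(2)] del: One_nat_def)
  qed
  have "signs n \<noteq> {}"
    by (auto simp: signs_def PiE_eq_empty_iff)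
  then have "(\<lambda>x. op_norm (mat_sum n (\<lambda>i. x i \<cdot>\<^sub>m mat_diag n (sign_row m h i)) {1..n})) ` signs n
      = {sqrt (real m)}"
    using norm by auto
  then show ?thesis
    unfolding disc_def by simp
qed

lemma op_norm_sign_family_squares:
  assumes "0 < m" "m \<le> n"
  shows "op_norm (mat_sum n (\<lambda>i. mat_diag n (sign_row m h i) ^\<^sub>m 2) {1..n}) = 1"
proof -
  have "mat_diag n (sign_row m h i) ^\<^sub>m 2
      = mat_diag n (\<lambda>j. sign_row m h i j * sign_row m h i j)" for i
    by (simp add: numeral_2_eq_2)
  then show ?thesis
    using assms
    by (simp add: mat_sum_mat_diag sum_sign_row_squares op_norm_mat_diag[of _ _ _ 0]
        del: One_nat_def mat_diag_one)
qed

lemma op_norm_sign_family_le_1: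
  assumes "0 < m" "0 < n"
  shows "op_norm (mat_diag n (sign_row m h i)) \<le> 1"
proof (cases "i \<in> {1..m}")
  case True
  then have "op_norm (mat_diag n (sign_row m h i)) = 1 / sqrt (real m)"
    using assms by (intro op_norm_mat_diag[of _ _ _ 0]) (auto simp: sign_row_def)
  then show ?thesis
    using assms by simp
next
  case False
  then have "op_norm (mat_diag n (sign_row m h i)) = 0"
    using assms by (intro op_norm_mat_diag[of _ _ _ 0]) (auto simp: sign_row_def)
  then show ?thesis
    by simp
qed

theorem theoremA1:
  shows "\<exists>c C :: real. 0 < c \<and> c \<le> C \<and>
    infinite {n :: nat. 0 < n \<and>
      (\<exists>A :: nat \<Rightarrow> real mat.
        (\<forall>i\<in>{1..n}. A i \<in> carrier_mat n n \<and> diagonal_mat (A i) \<and> op_norm (A i) \<le> 1) \<and>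
        c * sqrt (ln (real n)) \<le> disc n n A \<and>
        disc n n A \<le> C * sqrt (ln (real n)) \<and>
        c \<le> sqrt (op_norm (mat_sum n (\<lambda>i. A i ^\<^sub>m 2) {1..n})) \<and>
        sqrt (op_norm (mat_sum n (\<lambda>i. A i ^\<^sub>m 2) {1..n})) \<le> C)}"
    (is "\<exists>c C. _ \<and> _ \<and> infinite {n. ?P c C n}")
proof -
  have ln2: "0 < ln (2::real)" "ln (2::real) \<le> 1"
    using ln_le_minus_one[of "2::real"] by auto
  (* The constants come from sqrt (ln (2 ^ m)) = sqrt m * sqrt (ln 2). *)
  define C where "C = 1 / sqrt (ln 2 :: real)"
  have C: "1 \<le> C"
    using ln2 by (simp add: C_def)
  have P: "?P 1 C (2 ^ m)" if m: "0 < m" for m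
  proof -
    define n :: nat where "n = 2 ^ m"
    have n: "0 < n" "m \<le> n"
      by (auto simp: n_def less_imp_le)
    have "card (Pow {1..m}) = n"
      by (simp add: n_def card_Pow)
    then obtain h where "bij_betw h {..<n} (Pow {1..m})"
      using ex_bij_betw_nat_finite[of "Pow {1..m}"] by (auto simp: atLeast0LessThan)
    then have h: "Pow {1..m} \<subseteq> h ` {..<n}"
      by (simp add: bij_betw_def)
    define A where "A i = mat_diag n (sign_row m h i)" for i
    have disc: "disc n n A = sqrt (real m)"
      unfolding A_def using disc_sign_family[OF m n(2) h] .
    have squares: "op_norm (mat_sum n (\<lambda>i. A i ^\<^sub>m 2) {1..n}) = 1"
      unfolding A_def by (rule op_norm_sign_family_squares[OF m n(2)])
    have ln_n: "sqrt (ln (real n)) = sqrt (real m) * sqrt (ln 2)"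
      by (simp add: n_def ln_realpow real_sqrt_mult)
    have "1 * sqrt (ln (real n)) \<le> disc n n A"
      using mult_left_mono[of "sqrt (ln 2)" 1 "sqrt (real m)"] ln2 by (simp add: disc ln_n)
    moreover have "disc n n A \<le> C * sqrt (ln (real n))"
      using ln2 by (simp add: disc ln_n C_def)
    moreover have "A i \<in> carrier_mat n n \<and> diagonal_mat (A i) \<and> op_norm (A i) \<le> 1" for i
      using op_norm_sign_family_le_1[OF m n(1)]
      by (auto simp: A_def diagonal_mat_def mat_diag_def)
    ultimately show ?thesis
      using n(1) C squares unfolding n_def[symmetric] by (intro conjI exI[of _ A]) auto
  qed
  have "infinite (range (\<lambda>m. 2 ^ Suc m :: nat))"
    using finite_imageD[of "\<lambda>m. 2 ^ Suc m :: nat" UNIV] by (auto simp: inj_on_def)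
  moreover have "range (\<lambda>m. 2 ^ Suc m) \<subseteq> {n. ?P 1 C n}"
    using P[OF zero_less_Suc] by blast
  ultimately have "infinite {n. ?P 1 C n}"
    using infinite_super by blast
  then show ?thesis
    using C by (intro exI[of _ 1] exI[of _ C]) auto
qed

end
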